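(* Let $H_1,\dots,H_r$ be groups with a normalized $r$-total system $S^{(r)}$, and let $G=H_1\times\cdots\times H_r$ carry the associated multiplication $\mu$, written $x\cdot y$. Suppose that for all $i,j,k$ with $r\ge k\ge j\ge i\ge 1$ and all $a_k\in H_k$, $b_j\in H_j$, $c_i\in H_i$ (regarded as elements of $G$) one has $$(a_k\cdot b_j)\cdot c_i=a_k\cdot(b_j\cdot c_i).$$ Then $\mu$ is associative on all of $G$.
   Context: Let $r\ge1$ and let $H_1,\dots,H_r$ be groups. An $r$-total system $S^{(r)}$ consists of maps $\phi_k^j:H_k\to \mathrm{Maps}(H_j,H_j)$ for all $r\ge k>j\ge1$ (where $\mathrm{Maps}(H_j,H_j)$ is the set of all set-theoretic self-maps of $H_j$; the value of $\phi_k^j(h_k)$ at $h_j$ is written ${}^{\phi_k^j(h_k)}h_j$) and maps (brackets) $[\cdot,\cdot]_{kj}^i:H_k\times H_j\to H_i$ for all $r\ge k>j>i\ge1$. It is normalized if for all $r\ge k>j>i\ge1$: $\phi_j^i(1)=\mathrm{id}_{H_i}$, and (for all pairs of indices $j>i$) ${}^{\phi_j^i(h_j)}1=1$ for all $h_j\in H_j$; $[1,h_j]_{kj}^i=1$ for all $h_j\in H_j$; $[h_k,1]_{kj}^i=1$ for all $h_k\in H_k$. (The conditions on the actions $\phi_j^i$ are required for all $r\ge j>i\ge1$.) Let $G$ be the set $H_1\times\cdots\times H_r$. For $0\le k\le r$ let $R_k\subseteq G$ be the set of tuples $(h_1,\dots,h_k,1,\dots,1)$. An element $h_i\in H_i$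 is identified with the tuple in $G$ having $h_i$ in position $i$ and $1$ elsewhere. For $k>j$, $h_k\in H_k$, $h_j\in H_j$ put $$\phi_{h_k}(h_j)=\big([h_k,h_j]_{kj}^1,\dots,[h_k,h_j]_{kj}^{j-1},{}^{\phi_k^j(h_k)}h_j,1,\dots,1\big)\in R_j.$$ Multiplications $\mu_k:R_k\times R_k\to R_k$ are defined recursively. $\mu_1$ is the group law of $H_1$. Given $\mu_k$, write $\mu_k(w_1)=w_1$ and $\mu_k(w_1,\dots,w_m)=\mu_k(\mu_k(w_1,\dots,w_{m-1}),w_m)$ for $w_1,\dots,w_m\in R_k$; then for $a=(a_1,\dots,a_{k+1},1,\dots,1)$ and $b=(b_1,\dots,b_{k+1},1,\dots,1)$, $\mu_{k+1}(a,b)$ is the tuple whose first $k$ entries are those of $$\mu_k\big((a_1,\dots,a_k,1,\dots,1),\ \mu_k(\phi_{a_{k+1}}(b_1),\dots,\phi_{a_{k+1}}(b_k))\big),$$ whose $(k+1)$st entry is $a_{k+1}b_{k+1}$, and whose other entries are $1$. Put $\mu=\mu_r:G\times G\to G$, $x\cdot y=\mu(x,y)$. *)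

theory Defs
  imports "HOL-Algebra.Group" "HOL-Library.FuncSet"
begin

text \<open>
  The groups \<open>H 1, \<dots>, H r\<close> are carriers inside one common type; this is no restriction, since
  every finite family of groups has isomorphic copies inside the disjoint sum of their types.
  Only the values of \<open>H\<close>, \<open>act\<close> and \<open>br\<close> at the indices and carrier elements
  mentioned below are relevant.
  \<open>act k j x y\<close> is the value of the self-map \<open>\<phi>\<^sub>k\<^sup>j(x)\<close> of \<open>H j\<close> at \<open>y\<close>,
  and \<open>br k j i x y\<close> is the bracket \<open>[x, y]\<close> of \<open>x \<in> H k\<close> and \<open>y \<in> H j\<close> in \<open>H i\<close>.
\<close>

locale total_system =
  fixes r :: nat
    and H :: "nat \<Rightarrow> ('a, 'b) monoid_scheme"
    and act :: "nat \<Rightarrow> nat \<Rightarrow> 'a \<Rightarrow> 'a \<Rightarrow> 'a"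
    and br :: "nat \<Rightarrow> nat \<Rightarrow> nat \<Rightarrow> 'a \<Rightarrow> 'a \<Rightarrow> 'a"
  assumes r_pos: "1 \<le> r"
    and group_H: "\<lbrakk>1 \<le> i; i \<le> r\<rbrakk> \<Longrightarrow> group (H i)"
    and act_closed: "\<lbrakk>1 \<le> j; j < k; k \<le> r; x \<in> carrier (H k); y \<in> carrier (H j)\<rbrakk>
      \<Longrightarrow> act k j x y \<in> carrier (H j)"
    and br_closed: "\<lbrakk>1 \<le> i; i < j; j < k; k \<le> r; x \<in> carrier (H k); y \<in> carrier (H j)\<rbrakk>
      \<Longrightarrow> br k j i x y \<in> carrier (H i)"
begin

definition G :: "(nat \<Rightarrow> 'a) set" where
  "G = (\<Pi>\<^sub>E i\<in>{1..r}. carrier (H i))"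

definition embed :: "nat \<Rightarrow> 'a \<Rightarrow> nat \<Rightarrow> 'a" where
  "embed i h = (\<lambda>l\<in>{1..r}. if l = i then h else \<one>\<^bsub>H l\<^esub>)"

definition trunc :: "nat \<Rightarrow> (nat \<Rightarrow> 'a) \<Rightarrow> nat \<Rightarrow> 'a" where
  "trunc k a = (\<lambda>l\<in>{1..r}. if l \<le> k then a l else \<one>\<^bsub>H l\<^esub>)"

text \<open>\<open>Phi k j x y\<close> is \<open>\<phi>\<^bsub>x\<^esub>(y)\<close> for \<open>x \<in> H k\<close> and \<open>y \<in> H j\<close>, \<open>k > j\<close>.\<close>

definition Phi :: "nat \<Rightarrow> nat \<Rightarrow> 'a \<Rightarrow> 'a \<Rightarrow> nat \<Rightarrow> 'a" where
  "Phi k j x y = (\<lambda>l\<in>{1..r}.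
     if l < j then br k j l x y else if l = j then act k j x y else \<one>\<^bsub>H l\<^esub>)"

text \<open>
  \<open>mu k\<close> is intended for tuples in \<open>R\<^sub>k\<close>, those elements of \<open>G\<close> whose entries
  beyond position \<open>k\<close> are trivial. The recursion proper starts at \<open>mu 1\<close>; \<open>mu 0\<close> is the
  trivial law on \<open>R\<^sub>0\<close> and is used nowhere. The \<open>foldl\<close> is the left-bracketed product
  of \<open>Phi (k + 1) j (a (k + 1)) (b j)\<close> for \<open>j = 1, \<dots>, k\<close>.
\<close>

primrec mu :: "nat \<Rightarrow> (nat \<Rightarrow> 'a) \<Rightarrow> (nat \<Rightarrow> 'a) \<Rightarrow> nat \<Rightarrow> 'a" where
  "mu 0 = (\<lambda>a b. \<lambda>l\<in>{1..r}. \<one>\<^bsub>H l\<^esub>)"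
| "mu (Suc k) = (\<lambda>a b.
     if k = 0 then embed 1 (a 1 \<otimes>\<^bsub>H 1\<^esub> b 1)
     else
       let p = (\<lambda>j. Phi (Suc k) j (a (Suc k)) (b j));
           w = mu k (trunc k a) (foldl (mu k) (p 1) (map p [2..<Suc k]))
       in (\<lambda>l\<in>{1..r}.
            if l \<le> k then w l
            else if l = Suc k then a l \<otimes>\<^bsub>H l\<^esub> b l
            else \<one>\<^bsub>H l\<^esub>))"

definition mult :: "(nat \<Rightarrow> 'a) \<Rightarrow> (nat \<Rightarrow> 'a) \<Rightarrow> nat \<Rightarrow> 'a" where
  "mult = mu r"

end

locale normalized_total_system = total_system +
  assumes act_one: "\<lbrakk>1 \<le> i; i < j; j \<le> r; y \<in> carrier (H i)\<rbrakk>
      \<Longrightarrow> act j i \<one>\<^bsub>H j\<^esub> y = y"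
    and act_at_one: "\<lbrakk>1 \<le> i; i < j; j \<le> r; x \<in> carrier (H j)\<rbrakk>
      \<Longrightarrow> act j i x \<one>\<^bsub>H i\<^esub> = \<one>\<^bsub>H i\<^esub>"
    and br_one_left: "\<lbrakk>1 \<le> i; i < j; j < k; k \<le> r; y \<in> carrier (H j)\<rbrakk>
      \<Longrightarrow> br k j i \<one>\<^bsub>H k\<^esub> y = \<one>\<^bsub>H i\<^esub>"
    and br_one_right: "\<lbrakk>1 \<le> i; i < j; j < k; k \<le> r; x \<in> carrier (H k)\<rbrakk>
      \<Longrightarrow> br k j i x \<one>\<^bsub>H j\<^esub> = \<one>\<^bsub>H i\<^esub>"

end

theory Submission
  imports Defs
begin

text \<open>
  Write \<open>R k\<close> for the tuples supported on the first \<open>k\<close> positions. An element of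
  \<open>R (k + 1)\<close> is a pair \<open>(a, x)\<close> with \<open>a \<in> R k\<close> and \<open>x \<in> H (k + 1)\<close>, and the recursion
  says \<open>(a, x) (b, y) = (a \<cdot> \<phi>\<^sub>x(b), x y)\<close>, where
  \<open>\<phi>\<^sub>x(b) = \<phi>\<^sub>x(b 1) \<cdot> \<dots> \<cdot> \<phi>\<^sub>x(b k)\<close>. This is the multiplication of a semidirect product.
  Hence, once \<open>R k\<close> is associative, \<open>R (k + 1)\<close> is associative as soon as every
  \<open>\<phi>\<^sub>x\<close> is an endomorphism of \<open>R k\<close> and \<open>\<phi>\<^bsub>x y\<^esub> = \<phi>\<^sub>x \<circ> \<phi>\<^sub>y\<close>, and the theorem
  follows by induction on \<open>k\<close> (\<open>mult_assoc\<close>).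

  Normalization makes the levels fit together: the multiplication of each \<open>R k\<close> extends those
  of the lower levels and has the trivial tuple as unit, and every tuple is the ordered product of its
  entries (\<open>unital_tower_all\<close>). So each \<open>R k\<close> is generated by the embedded groups, and the two
  properties of \<open>\<phi>\<close> are to be reduced to generators, where they are what the hypothesis gives:
  comparing first components in \<open>(x \<cdot> b) \<cdot> c = x \<cdot> (b \<cdot> c)\<close> yields
  \<open>\<phi>\<^sub>x(b \<cdot> c) = \<phi>\<^sub>x(b) \<cdot> \<phi>\<^sub>x(c)\<close> for \<open>b \<in> H j\<close>, \<open>c \<in> H i\<close>, \<open>i \<le> j \<le> k\<close>, and
  in \<open>(x \<cdot> y) \<cdot> c = x \<cdot> (y \<cdot> c)\<close> yields \<open>\<phi>\<^bsub>x y\<^esub>(c) = \<phi>\<^sub>x(\<phi>\<^sub>y(c))\<close>. The second one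
  extends to all \<open>c\<close> as soon as the \<open>\<phi>\<^sub>x\<close> are endomorphisms.

  The point is the endomorphism property (\<open>twist_hom\<close>). It is proved on \<open>R l\<close> by induction
  on \<open>l \<le> k\<close>. By definition \<open>\<phi>\<^sub>x\<close> is multiplicative on products whose factors come in the
  order of increasing position, and the hypothesis gives \<open>\<phi>\<^sub>x(y z) = \<phi>\<^sub>x(y) \<cdot> \<phi>\<^sub>x(z)\<close> for
  \<open>y, z \<in> H (l + 1)\<close>. So for \<open>(a, y)\<close> and \<open>(b, z)\<close> in \<open>R (l + 1)\<close> all that is missing is that
  moving \<open>y\<close> to the right across \<open>b\<close>, which replaces \<open>b\<close> by \<open>\<phi>\<^sub>y(b)\<close>, is
  respected by \<open>\<phi>\<^sub>x\<close>. For a single entry of \<open>b\<close> this is the hypothesis, and the entries are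
  crossed one at a time (\<open>twist_mult_swap\<close>).
\<close>

context normalized_total_system
begin

section \<open>Tuples supported on an initial segment\<close>

definition R :: "nat \<Rightarrow> (nat \<Rightarrow> 'a) set" where
  "R k = {a \<in> G. \<forall>l. k < l \<and> l \<le> r \<longrightarrow> a l = \<one>\<^bsub>H l\<^esub>}"

definition unit :: "nat \<Rightarrow> 'a" where
  "unit = (\<lambda>l\<in>{1..r}. \<one>\<^bsub>H l\<^esub>)"

lemma R_r: "R r = G"
  by (auto simp: R_def)

lemma R_mono: "k \<le> l \<Longrightarrow> R k \<subseteq> R l"
  by (auto simp: R_def)

lemma one_closed_H: "\<lbrakk>1 \<le> i; i \<le> r\<rbrakk> \<Longrightarrow> \<one>\<^bsub>H i\<^esub> \<in> carrier (H i)"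
  using group_H group.is_monoid monoid.one_closed by blast

lemma R_entry: "\<lbrakk>a \<in> R k; 1 \<le> l; l \<le> r\<rbrakk> \<Longrightarrow> a l \<in> carrier (H l)"
  by (auto simp: R_def G_def PiE_def Pi_def)

lemma R_outside: "\<lbrakk>a \<in> R k; k < l; l \<le> r\<rbrakk> \<Longrightarrow> a l = \<one>\<^bsub>H l\<^esub>"
  by (auto simp: R_def)

lemma unit_in_R: "unit \<in> R k"
  by (auto simp: R_def G_def unit_def one_closed_H)

lemma R_0: "R 0 = {unit}"
proof -
  have "a = unit" if "a \<in> R 0" for a
  proof
    fix l
    show "a l = unit l"
      using that by (cases "l \<in> {1..r}") (auto simp: R_def G_def unit_def)
  qed
  with unit_in_R show ?thesis by blast
qed

lemma R_update: "\<lbrakk>a \<in> R k; k < r; x \<in> carrier (H (Suc k))\<rbrakk> \<Longrightarrow> a(Suc k := x) \<in> R (Suc k)"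
  by (auto simp: R_def G_def PiE_def Pi_def extensional_def)

lemma trunc_in_R: "a \<in> R l \<Longrightarrow> trunc k a \<in> R k"
  by (auto simp: R_def trunc_def G_def PiE_def Pi_def extensional_def one_closed_H)

lemma trunc_update: "a \<in> R k \<Longrightarrow> trunc k (a(Suc k := x)) = a"
  by (rule ext) (auto simp: R_def trunc_def G_def PiE_def Pi_def extensional_def)

lemma trunc_Suc: "k < r \<Longrightarrow> (trunc k a)(Suc k := a (Suc k)) = trunc (Suc k) a"
  by (rule ext) (auto simp: trunc_def)

lemma trunc_split: "\<lbrakk>a \<in> R (Suc k); k < r\<rbrakk> \<Longrightarrow> (trunc k a)(Suc k := a (Suc k)) = a"
  by (rule ext) (auto simp: R_def trunc_def G_def PiE_def Pi_def extensional_def)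

lemma R_Suc_cases:
  assumes "a \<in> R (Suc k)" "k < r"
  obtains b x where "b \<in> R k" "x \<in> carrier (H (Suc k))" "a = b(Suc k := x)"
proof
  show "trunc k a \<in> R k" using assms trunc_in_R by blast
  show "a (Suc k) \<in> carrier (H (Suc k))" using assms R_entry by simp
  show "a = (trunc k a)(Suc k := a (Suc k))" using assms trunc_split by simp
qed

lemma update_one: "\<lbrakk>a \<in> R k; k < r\<rbrakk> \<Longrightarrow> a(Suc k := \<one>\<^bsub>H (Suc k)\<^esub>) = a"
  by (rule ext) (auto simp: R_def)

lemma embed_Suc: "k < r \<Longrightarrow> embed (Suc k) h = unit(Suc k := h)"
  by (rule ext) (auto simp: embed_def unit_def)

lemma embed_in_R: "\<lbrakk>1 \<le> i; i \<le> k; i \<le> r; h \<in> carrier (H i)\<rbrakk> \<Longrightarrow> embed i h \<in> R k"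
  by (auto simp: embed_def R_def G_def one_closed_H)

lemma Phi_in_R:
  "\<lbrakk>1 \<le> j; j < k; k \<le> r; x \<in> carrier (H k); y \<in> carrier (H j)\<rbrakk> \<Longrightarrow> Phi k j x y \<in> R j"
  by (auto simp: Phi_def R_def G_def one_closed_H act_closed br_closed)

lemma Phi_one_left:
  "\<lbrakk>1 \<le> j; j < k; k \<le> r; y \<in> carrier (H j)\<rbrakk> \<Longrightarrow> Phi k j \<one>\<^bsub>H k\<^esub> y = embed j y"
  by (rule ext) (auto simp: Phi_def embed_def act_one br_one_left)

lemma Phi_one_right:
  "\<lbrakk>1 \<le> j; j < k; k \<le> r; x \<in> carrier (H k)\<rbrakk> \<Longrightarrow> Phi k j x \<one>\<^bsub>H j\<^esub> = unit"
  by (rule ext) (auto simp: Phi_def unit_def act_at_one br_one_right)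

section \<open>The recursion as a semidirect product law\<close>

text \<open>
  \<open>twist_upto l k x b\<close> is the partial product \<open>\<phi>\<^sub>x(b 1) \<cdot> \<dots> \<cdot> \<phi>\<^sub>x(b l)\<close> in level \<open>k\<close>,
  for \<open>x \<in> H (k + 1)\<close>. Starting the fold at the unit, rather than at the first factor, makes
  the case \<open>l = 0\<close> meaningful, so that inductions can start at the trivial level \<open>R 0\<close>.
\<close>

definition twist_upto :: "nat \<Rightarrow> nat \<Rightarrow> 'a \<Rightarrow> (nat \<Rightarrow> 'a) \<Rightarrow> nat \<Rightarrow> 'a" where
  "twist_upto l k x b = foldl (mu k) unit (map (\<lambda>j. Phi (Suc k) j x (b j)) [1..<Suc l])"

abbreviation twist :: "nat \<Rightarrow> 'a \<Rightarrow> (nat \<Rightarrow> 'a) \<Rightarrow> nat \<Rightarrow> 'a" where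
  "twist k \<equiv> twist_upto k k"

lemma twist_upto_0: "twist_upto 0 k x b = unit"
  by (simp add: twist_upto_def)

lemma twist_upto_Suc:
  "twist_upto (Suc l) k x b = mu k (twist_upto l k x b) (Phi (Suc k) (Suc l) x (b (Suc l)))"
  by (simp add: twist_upto_def)

text \<open>
  The statements collected here need each other in the induction on \<open>k\<close>. That level \<open>k + 1\<close>
  extends level \<open>k\<close> rests on \<open>\<phi>\<close> at the neutral element of \<open>H (k + 1)\<close> being the identity,
  which says that \<open>b\<close> is the ordered product of its entries in level \<open>k\<close>. That in turn is the last clause, and it is transported to the next level
  by the extension property.
\<close>

definition unital_tower :: "nat \<Rightarrow> bool" where
  "unital_tower k \<longleftrightarrow>
     (\<forall>a\<in>R k. mu k unit a = a \<and> mu k a unit = a) \<and>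
     (\<forall>l\<le>k. \<forall>a\<in>R l. \<forall>b\<in>R l. mu k a b = mu l a b \<and> mu k a b \<in> R l) \<and>
     (\<forall>l<k. \<forall>a\<in>R l. \<forall>h\<in>carrier (H (Suc l)). mu k a (embed (Suc l) h) = a(Suc l := h))"

lemma tower_restrict: "\<lbrakk>unital_tower k; l \<le> k; a \<in> R l; b \<in> R l\<rbrakk> \<Longrightarrow> mu k a b = mu l a b"
  and tower_closed: "\<lbrakk>unital_tower k; l \<le> k; a \<in> R l; b \<in> R l\<rbrakk> \<Longrightarrow> mu k a b \<in> R l"
  unfolding unital_tower_def by blast+

text \<open>
  The semidirect product form of the recursion. At \<open>k = 0\<close> it reproduces the group law of \<open>H 1\<close>,
  so the first level needs no separate treatment.
\<close>

lemma mu_Suc: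
  assumes "unital_tower k" "k < r" "a \<in> R (Suc k)" "b \<in> R (Suc k)"
    and closed: "twist k (a (Suc k)) b \<in> R k"
  shows "mu (Suc k) a b
    = (mu k (trunc k a) (twist k (a (Suc k)) b))(Suc k := a (Suc k) \<otimes>\<^bsub>H (Suc k)\<^esub> b (Suc k))"
proof (cases "k = 0")
  case True
  then show ?thesis
    using assms(2) embed_Suc[of 0] by (simp add: twist_upto_0 unit_def restrict_def fun_eq_iff)
next
  case False
  define p where "p = (\<lambda>j. Phi (Suc k) j (a (Suc k)) (b j))"
  have "p 1 \<in> R k"
    unfolding p_def using False assms(2-4)
    by (intro subsetD[OF R_mono Phi_in_R] R_entry) auto
  then have "mu k unit (p 1) = p 1"
    using assms(1) by (simp add: unital_tower_def)
  moreover have "[1..<Suc k] = 1 # [2..<Suc k]"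
    using False by (simp add: upt_conv_Cons numeral_2_eq_2)
  ultimately have tw: "twist k (a (Suc k)) b = foldl (mu k) (p 1) (map p [2..<Suc k])"
    by (simp add: twist_upto_def p_def del: upt_Suc)
  define w where "w = mu k (trunc k a) (twist k (a (Suc k)) b)"
  have w: "w \<in> R k"
    unfolding w_def using assms trunc_in_R closed by (simp add: tower_closed)
  have "mu (Suc k) a b = (\<lambda>l\<in>{1..r}. if l \<le> k then w l
      else if l = Suc k then a l \<otimes>\<^bsub>H l\<^esub> b l else \<one>\<^bsub>H l\<^esub>)"
    unfolding w_def tw p_def using False by (simp add: Let_def del: upt_Suc cong: if_cong)
  also have "\<dots> = w(Suc k := a (Suc k) \<otimes>\<^bsub>H (Suc k)\<^esub> b (Suc k))"
    using w \<open>k < r\<close> by (auto simp: fun_eq_iff R_def G_def PiE_def extensional_def)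
  finally show ?thesis
    by (simp add: w_def)
qed

declare mu.simps(2) [simp del]

lemma twist_upto_in_R:
  assumes "unital_tower k" "k < r" "x \<in> carrier (H (Suc k))" "b \<in> R n" "l \<le> k"
  shows "twist_upto l k x b \<in> R l"
  using \<open>l \<le> k\<close>
proof (induction l)
  case 0
  then show ?case by (simp add: twist_upto_0 unit_in_R)
next
  case (Suc l)
  have "twist_upto l k x b \<in> R (Suc l)"
    using Suc R_mono[of l "Suc l"] by auto
  moreover have "Phi (Suc k) (Suc l) x (b (Suc l)) \<in> R (Suc l)"
    using Suc.prems assms R_entry by (intro Phi_in_R) auto
  ultimately show ?case
    using tower_closed[OF assms(1) Suc.prems] by (simp add: twist_upto_Suc)
qed

lemma twist_upto_beyond:
  assumes "unital_tower k" "k < r" "x \<in> carrier (H (Suc k))" "b \<in> R n" "n \<le> l" "l \<le> k"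
  shows "twist_upto l k x b = twist_upto n k x b"
  using \<open>n \<le> l\<close> \<open>l \<le> k\<close>
proof (induction l rule: dec_induct)
  case base
  then show ?case by simp
next
  case (step l)
  have "b (Suc l) = \<one>\<^bsub>H (Suc l)\<^esub>"
    using step assms by (intro R_outside[of b n]) auto
  then have "Phi (Suc k) (Suc l) x (b (Suc l)) = unit"
    using step assms Phi_one_right by simp
  moreover have "twist_upto l k x b \<in> R k"
    using step assms twist_upto_in_R[of k x b n l] R_mono[of l k] by auto
  ultimately show ?case
    using step assms(1) by (simp add: twist_upto_Suc unital_tower_def)
qed

text \<open>The twist by \<open>1\<close> multiplies the entries of \<open>b\<close> back together in their order.\<close>

lemma twist_upto_one:
  assumes "unital_tower k" "k < r" "b \<in> R n" "l \<le> k"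
  shows "twist_upto l k \<one>\<^bsub>H (Suc k)\<^esub> b = trunc l b"
  using \<open>l \<le> k\<close>
proof (induction l)
  case 0
  then show ?case by (auto simp: twist_upto_0 trunc_def unit_def fun_eq_iff)
next
  case (Suc l)
  have b: "b (Suc l) \<in> carrier (H (Suc l))"
    using Suc assms R_entry by simp
  have "twist_upto (Suc l) k \<one>\<^bsub>H (Suc k)\<^esub> b = mu k (trunc l b) (embed (Suc l) (b (Suc l)))"
    using Suc assms b Phi_one_left by (simp add: twist_upto_Suc)
  also have "\<dots> = (trunc l b)(Suc l := b (Suc l))"
    using Suc assms b trunc_in_R by (simp add: unital_tower_def)
  also have "\<dots> = trunc (Suc l) b"
    using Suc assms by (simp add: trunc_Suc)
  finally show ?case .
qed

lemma unital_tower_Suc: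
  assumes "unital_tower k" "k < r"
  shows "unital_tower (Suc k)"
proof -
  have grp: "group (H (Suc k))"
    using assms(2) group_H by simp
  have unit_update: "unit(Suc k := \<one>\<^bsub>H (Suc k)\<^esub>) = unit"
    using update_one[OF unit_in_R] assms(2) by blast
  have unit_Suc: "unit (Suc k) = \<one>\<^bsub>H (Suc k)\<^esub>"
    using unit_update by (metis fun_upd_same)
  have mu: "mu (Suc k) (a(Suc k := x)) (b(Suc k := y))
      = (mu k a (twist k x (b(Suc k := y))))(Suc k := x \<otimes>\<^bsub>H (Suc k)\<^esub> y)"
    and tw: "twist k x (b(Suc k := y)) \<in> R k"
    if "a \<in> R k" "b \<in> R k" "x \<in> carrier (H (Suc k))" "y \<in> carrier (H (Suc k))" for a b x y
  proof -
    show "twist k x (b(Suc k := y)) \<in> R k"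
      using that assms by (intro twist_upto_in_R[OF _ _ _ R_update]) auto
    then show "mu (Suc k) (a(Suc k := x)) (b(Suc k := y))
      = (mu k a (twist k x (b(Suc k := y))))(Suc k := x \<otimes>\<^bsub>H (Suc k)\<^esub> y)"
      using that assms by (subst mu_Suc) (auto simp: R_update trunc_update)
  qed
  have one: "\<one>\<^bsub>H (Suc k)\<^esub> \<in> carrier (H (Suc k))"
    using assms(2) one_closed_H by simp
  have tw_one: "twist k \<one>\<^bsub>H (Suc k)\<^esub> (b(Suc k := y)) = b"
    if "b \<in> R k" "y \<in> carrier (H (Suc k))" for b y
    using that assms twist_upto_one[OF assms R_update[OF that(1) assms(2) that(2)] le_refl]
    by (simp add: trunc_update)
  have tw_unit: "twist k x unit = unit" if "x \<in> carrier (H (Suc k))" for x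
    using that assms twist_upto_beyond[of k x unit 0 k] unit_in_R by (simp add: twist_upto_0)
  have closed: "mu (Suc k) a b \<in> R (Suc k)" if "a \<in> R (Suc k)" "b \<in> R (Suc k)" for a b
  proof -
    obtain a' x where a: "a' \<in> R k" "x \<in> carrier (H (Suc k))" "a = a'(Suc k := x)"
      using R_Suc_cases[OF \<open>a \<in> R (Suc k)\<close> assms(2)] by blast
    obtain b' y where b: "b' \<in> R k" "y \<in> carrier (H (Suc k))" "b = b'(Suc k := y)"
      using R_Suc_cases[OF \<open>b \<in> R (Suc k)\<close> assms(2)] by blast
    have "mu k a' (twist k x b) \<in> R k"
      using tower_closed[OF assms(1) le_refl a(1) tw[OF a(1) b(1) a(2) b(2)]] b(3) by simp
    moreover have "x \<otimes>\<^bsub>H (Suc k)\<^esub> y \<in> carrier (H (Suc k))"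
      using a b grp by (simp add: group.is_monoid monoid.m_closed)
    ultimately show ?thesis
      using mu[OF a(1) b(1) a(2) b(2)] a b assms(2) R_update by simp
  qed
  have units: "mu (Suc k) unit a = a \<and> mu (Suc k) a unit = a" if a_in: "a \<in> R (Suc k)" for a
  proof -
    obtain a' x where a: "a' \<in> R k" "x \<in> carrier (H (Suc k))" "a = a'(Suc k := x)"
      using R_Suc_cases[OF a_in assms(2)] by blast
    have "mu (Suc k) unit a = a"
      using mu[OF unit_in_R a(1) one a(2)] tw_one[OF a(1,2)] a grp assms(1)
      by (simp add: unit_update unital_tower_def group.is_monoid monoid.l_one)
    moreover have "mu (Suc k) a unit = a"
      using mu[OF a(1) unit_in_R a(2) one] tw_unit[OF a(2)] a grp assms(1)
      by (simp add: unit_update unital_tower_def group.is_monoid monoid.r_one)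
    ultimately show ?thesis by blast
  qed
  have step: "mu (Suc k) a b = mu k a b" if "a \<in> R k" "b \<in> R k" for a b
  proof -
    have "mu k a b \<in> R k"
      using that tower_closed[OF assms(1) le_refl] by blast
    then show ?thesis
      using mu[OF that one one] tw_one[OF that(2) one] that grp assms(2)
      by (simp add: update_one group.is_monoid monoid.l_one one)
  qed
  have extends: "mu (Suc k) a b = mu l a b \<and> mu (Suc k) a b \<in> R l"
    if "l \<le> Suc k" "a \<in> R l" "b \<in> R l" for a b l
  proof (cases "l = Suc k")
    case True
    with that closed show ?thesis by simp
  next
    case False
    with that have "l \<le> k" by simp
    then show ?thesis
      using that step R_mono[of l k] tower_restrict[OF assms(1)] tower_closed[OF assms(1)]
      by (metis subsetD)
  qed
  have snoc: "mu (Suc k) a (embed (Suc l) h) = a(Suc l := h)"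
    if "l < Suc k" "a \<in> R l" "h \<in> carrier (H (Suc l))" for a h l
  proof (cases "l = k")
    case True
    then have "a(Suc k := \<one>\<^bsub>H (Suc k)\<^esub>) = a" "embed (Suc l) h = unit(Suc k := h)"
      using that assms(2) by (auto simp: update_one embed_Suc)
    then show ?thesis
      using True that mu[OF _ unit_in_R one, of a h] tw_one[OF unit_in_R, of h] assms(1) grp
      by (simp add: unital_tower_def group.is_monoid monoid.l_one)
  next
    case False
    then have "l < k" using that by simp
    moreover have "a \<in> R k" "embed (Suc l) h \<in> R k"
      using that \<open>l < k\<close> assms(2) R_mono[of l k] embed_in_R[of "Suc l" k h] by auto
    ultimately show ?thesis
      using that step assms(1) by (simp add: unital_tower_def)
  qed
  show ?thesis
    unfolding unital_tower_def by (intro conjI ballI allI impI)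
      (rule units[THEN conjunct1] units[THEN conjunct2] extends[THEN conjunct1]
        extends[THEN conjunct2] snoc; assumption)+
qed

lemma unital_tower_all: "k \<le> r \<Longrightarrow> unital_tower k"
proof (induction k)
  case 0
  have "mu 0 a b = unit" for a b by (simp add: unit_def)
  then show ?case by (simp add: unital_tower_def R_0)
next
  case (Suc k)
  then show ?case by (simp add: unital_tower_Suc)
qed

section \<open>Twists as maps on the whole tower\<close>

abbreviation product (infixl "\<cdot>" 70) where
  "a \<cdot> b \<equiv> mult a b"

lemma mu_eq_mult: "\<lbrakk>k \<le> r; a \<in> R k; b \<in> R k\<rbrakk> \<Longrightarrow> mu k a b = a \<cdot> b"
  unfolding mult_def by (rule tower_restrict[OF unital_tower_all[OF le_refl], symmetric])

lemma mult_closed: "\<lbrakk>k \<le> r; a \<in> R k; b \<in> R k\<rbrakk> \<Longrightarrow> a \<cdot> b \<in> R k"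
  unfolding mult_def by (rule tower_closed[OF unital_tower_all[OF le_refl]])

lemma mult_unit:
  assumes "k \<le> r" "a \<in> R k"
  shows "unit \<cdot> a = a" "a \<cdot> unit = a"
  using unital_tower_all[of r] assms R_mono[of k r] by (auto simp: unital_tower_def mult_def)

lemma mult_embed:
  "\<lbrakk>l < r; a \<in> R l; h \<in> carrier (H (Suc l))\<rbrakk> \<Longrightarrow> a \<cdot> embed (Suc l) h = a(Suc l := h)"
  using unital_tower_all[of r] by (simp add: unital_tower_def mult_def)

lemma twist_in_R:
  assumes "k < r" "x \<in> carrier (H (Suc k))" "b \<in> R l" "l \<le> k"
  shows "twist k x b \<in> R l"
  using assms twist_upto_in_R[of k x b l l] twist_upto_beyond[of k x b l k] unital_tower_all[of k]
  by simp

lemma twist_unit: "\<lbrakk>k < r; x \<in> carrier (H (Suc k))\<rbrakk> \<Longrightarrow> twist k x unit = unit"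
  using twist_in_R[of k x unit 0] by (simp add: R_0)

lemma twist_upto_cong:
  "(\<And>j. \<lbrakk>1 \<le> j; j \<le> l\<rbrakk> \<Longrightarrow> b j = c j) \<Longrightarrow> twist_upto l k x b = twist_upto l k x c"
  by (induction l) (auto simp: twist_upto_0 twist_upto_Suc)

lemma mult_update:
  assumes "k < r" "a \<in> R k" "b \<in> R k" "x \<in> carrier (H (Suc k))" "y \<in> carrier (H (Suc k))"
  shows "a(Suc k := x) \<cdot> b(Suc k := y) = (a \<cdot> twist k x b)(Suc k := x \<otimes>\<^bsub>H (Suc k)\<^esub> y)"
proof -
  have tw: "twist k x (b(Suc k := y)) = twist k x b"
    by (rule twist_upto_cong) simp
  have "twist k x b \<in> R k"
    using assms twist_in_R by blast
  then show ?thesis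
    using assms tw mu_Suc[of k "a(Suc k := x)" "b(Suc k := y)"] unital_tower_all[of k]
    by (simp add: R_update trunc_update mu_eq_mult)
qed

text \<open>
  Appending an entry beyond the support of \<open>b\<close> appends a factor to the product defining
  \<open>\<phi>\<^sub>x(b)\<close>; the remaining factors are trivial.
\<close>

lemma twist_snoc:
  assumes "k < r" "l < k" "x \<in> carrier (H (Suc k))" "b \<in> R l" "h \<in> carrier (H (Suc l))"
  shows "twist k x (b \<cdot> embed (Suc l) h) = twist k x b \<cdot> Phi (Suc k) (Suc l) x h"
proof -
  note tower = unital_tower_all[OF less_imp_le[OF \<open>k < r\<close>]]
  have "b(Suc l := h) \<in> R (Suc l)"
    using assms by (intro R_update) auto
  then have "twist k x (b(Suc l := h)) = twist_upto (Suc l) k x (b(Suc l := h))"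
    using assms twist_upto_beyond[OF tower, of x _ "Suc l" k] by simp
  also have "\<dots> = mu k (twist_upto l k x b) (Phi (Suc k) (Suc l) x h)"
    using twist_upto_cong[of l "b(Suc l := h)" b k x] by (simp add: twist_upto_Suc)
  also have "twist_upto l k x b = twist k x b"
    using assms twist_upto_beyond[OF tower, of x b l k] by simp
  also have "mu k (twist k x b) (Phi (Suc k) (Suc l) x h) = twist k x b \<cdot> Phi (Suc k) (Suc l) x h"
    using assms twist_in_R[of k x b l] R_mono[of l k] R_mono[of "Suc l" k]
      Phi_in_R[of "Suc l" "Suc k" x h]
    by (intro mu_eq_mult) auto
  finally show ?thesis
    using mult_embed[OF _ assms(4,5)] assms(1,2) by (metis less_trans)
qed

lemma twist_embed:
  assumes "k < r" "l < k" "x \<in> carrier (H (Suc k))" "h \<in> carrier (H (Suc l))"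
  shows "twist k x (embed (Suc l) h) = Phi (Suc k) (Suc l) x h"
  using twist_snoc[OF assms(1-3) unit_in_R assms(4)] assms embed_in_R[of "Suc l" k h]
    Phi_in_R[of "Suc l" "Suc k" x h] mult_unit[of k] R_mono[of "Suc l" k]
  by (auto simp: twist_unit)

lemma twist_mult_embed:
  assumes "k < r" "l < k" "x \<in> carrier (H (Suc k))" "b \<in> R l" "h \<in> carrier (H (Suc l))"
  shows "twist k x (b \<cdot> embed (Suc l) h) = twist k x b \<cdot> twist k x (embed (Suc l) h)"
  using assms by (simp add: twist_snoc twist_embed)

text \<open>
  The commutation rule of the semidirect product: \<open>x\<close> moves to the right across \<open>b\<close> at the
  cost of twisting \<open>b\<close>.
\<close>

lemma embed_mult:
  assumes "k < r" "x \<in> carrier (H (Suc k))" "b \<in> R k"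
  shows "embed (Suc k) x \<cdot> b = twist k x b \<cdot> embed (Suc k) x"
proof -
  have grp: "group (H (Suc k))"
    using assms(1) group_H by simp
  then have one: "\<one>\<^bsub>H (Suc k)\<^esub> \<in> carrier (H (Suc k))"
    by (simp add: group.is_monoid monoid.one_closed)
  have tw: "twist k x b \<in> R k"
    using assms twist_in_R by blast
  have "embed (Suc k) x \<cdot> b = (unit \<cdot> twist k x b)(Suc k := x)"
    using mult_update[OF assms(1) unit_in_R assms(3,2) one] assms grp
    by (simp add: embed_Suc update_one group.is_monoid monoid.r_one)
  then show ?thesis
    using tw assms mult_unit[of k "twist k x b"] mult_embed by simp
qed

lemma R_Suc_mult_cases:
  assumes "a \<in> R (Suc k)" "k < r"
  obtains b h where "b \<in> R k" "h \<in> carrier (H (Suc k))" "a = b \<cdot> embed (Suc k) h"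
proof -
  obtain b h where b: "b \<in> R k" "h \<in> carrier (H (Suc k))" "a = b(Suc k := h)"
    using R_Suc_cases[OF assms] by blast
  show ?thesis
    by (rule that[OF b(1,2)]) (simp only: b(3) mult_embed[OF assms(2) b(1,2)])
qed

lemma R_induct [consumes 2, case_names unit snoc]:
  assumes "b \<in> R k" "k \<le> r"
    and "P unit"
    and "\<And>l b h. \<lbrakk>l < k; b \<in> R l; h \<in> carrier (H (Suc l)); P b\<rbrakk>
      \<Longrightarrow> P (b \<cdot> embed (Suc l) h)"
  shows "P b"
proof -
  have "\<forall>b\<in>R l. P b" if "l \<le> k" for l
    using that
  proof (induction l)
    case 0
    then show ?case using assms(3) by (simp add: R_0)
  next
    case (Suc l)
    show ?case
    proof
      fix b assume b: "b \<in> R (Suc l)"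
      have "l < r" using Suc.prems assms(2) by simp
      obtain c h where c: "c \<in> R l" "h \<in> carrier (H (Suc l))" "b = c \<cdot> embed (Suc l) h"
        using R_Suc_mult_cases[OF b \<open>l < r\<close>] by blast
      have "P c" using Suc.IH Suc.prems c(1) by simp
      with c show "P b" using assms(4) Suc.prems by simp
    qed
  qed
  with assms(1) show ?thesis by blast
qed

lemma embed_mult_embed:
  assumes "k < r" "x \<in> carrier (H (Suc k))" "y \<in> carrier (H (Suc k))"
  shows "embed (Suc k) x \<cdot> embed (Suc k) y = embed (Suc k) (x \<otimes>\<^bsub>H (Suc k)\<^esub> y)"
  using mult_update[OF assms(1) unit_in_R unit_in_R assms(2,3)] assms
  by (simp add: embed_Suc twist_unit mult_unit[of k] unit_in_R)

section \<open>Associativity\<close>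

text \<open>
  In other words, \<open>\<phi>\<^sub>x\<close> respects the commutation rule \<open>\<phi>\<^sub>y(b) \<cdot> y = y \<cdot> b\<close>. When \<open>b\<close> is
  a single entry, \<open>gens\<close> evaluates \<open>\<phi>\<^sub>x(y \<cdot> b)\<close>, and in \<open>\<phi>\<^sub>y(b) \<cdot> y\<close> the positions increase,
  so that \<open>\<phi>\<^sub>x\<close> is multiplicative on it by definition. In general
  the entries of \<open>b\<close> are crossed one by one. The hypothesis \<open>hom\<close> splits
  \<open>\<phi>\<^sub>x(\<phi>\<^sub>y(b) \<cdot> \<phi>\<^sub>y(c))\<close>: here \<open>\<phi>\<^sub>y(c)\<close> is spread over all
  positions up to that of \<open>c\<close>, and the two factors are not in increasing order.
\<close>

lemma twist_mult_swap:
  assumes "k < r" "l < k" and x: "x \<in> carrier (H (Suc k))" and y: "y \<in> carrier (H (Suc l))"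
    and assoc: "\<And>a b c. \<lbrakk>a \<in> R k; b \<in> R k; c \<in> R k\<rbrakk> \<Longrightarrow> (a \<cdot> b) \<cdot> c = a \<cdot> (b \<cdot> c)"
    and gens: "\<And>i h. \<lbrakk>i < l; h \<in> carrier (H (Suc i))\<rbrakk> \<Longrightarrow>
      twist k x (embed (Suc l) y \<cdot> embed (Suc i) h)
      = twist k x (embed (Suc l) y) \<cdot> twist k x (embed (Suc i) h)"
    and hom: "\<And>a b. \<lbrakk>a \<in> R l; b \<in> R l\<rbrakk> \<Longrightarrow> twist k x (a \<cdot> b) = twist k x a \<cdot> twist k x b"
    and b: "b \<in> R l"
  shows "twist k x (twist l y b) \<cdot> twist k x (embed (Suc l) y)
    = twist k x (embed (Suc l) y) \<cdot> twist k x b"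
proof -
  have lr: "l < r" using assms by simp
  have sub: "R l \<subseteq> R k" using R_mono \<open>l < k\<close> by simp
  have X: "twist k x a \<in> R k" if "a \<in> R k" for a
    using twist_in_R[OF \<open>k < r\<close> x that le_refl] .
  have Y: "twist l y a \<in> R l" if "a \<in> R l" for a
    using twist_in_R[OF lr y that le_refl] .
  let ?y = "embed (Suc l) y"
  have yk: "?y \<in> R k" using embed_in_R[of "Suc l" k y] lr y \<open>l < k\<close> by simp
  have lr': "l \<le> r" using lr by simp
  from b lr' show ?thesis
  proof (induction b rule: R_induct)
    case unit
    then show ?case
      using \<open>k < r\<close> lr x y X[OF yk] by (simp add: twist_unit mult_unit[of k])
  next
    case (snoc i b h)
    let ?c = "embed (Suc i) h"
    have b: "b \<in> R l" using snoc R_mono[of i l] by auto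
    have c: "?c \<in> R l" using embed_in_R[of "Suc i" l h] snoc lr by simp
    have tb: "twist l y b \<in> R l" and tc: "twist l y ?c \<in> R l"
      using Y b c by auto
    have in_k: "b \<in> R k" "?c \<in> R k" "?y \<in> R k" "twist l y b \<in> R k" "twist l y ?c \<in> R k"
      using b c tb tc sub yk by auto
    have "twist k x (twist l y (b \<cdot> ?c)) \<cdot> twist k x ?y
      = (twist k x (twist l y b) \<cdot> twist k x (twist l y ?c)) \<cdot> twist k x ?y"
      using twist_mult_embed[OF lr _ y] snoc hom[OF tb tc] by simp
    also have "\<dots> = twist k x (twist l y b) \<cdot> (twist k x (twist l y ?c) \<cdot> twist k x ?y)"
      using in_k by (simp only: assoc X)
    also have "twist k x (twist l y ?c) \<cdot> twist k x ?y = twist k x (twist l y ?c \<cdot> ?y)"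
      using twist_mult_embed[OF \<open>k < r\<close> \<open>l < k\<close> x tc y] by simp
    also have "twist l y ?c \<cdot> ?y = ?y \<cdot> ?c"
      using embed_mult[OF lr y c] by simp
    also have "twist k x (?y \<cdot> ?c) = twist k x ?y \<cdot> twist k x ?c"
      using gens snoc by simp
    also have "twist k x (twist l y b) \<cdot> (twist k x ?y \<cdot> twist k x ?c)
      = (twist k x (twist l y b) \<cdot> twist k x ?y) \<cdot> twist k x ?c"
      using in_k by (simp only: assoc X)
    also have "\<dots> = (twist k x ?y \<cdot> twist k x b) \<cdot> twist k x ?c"
      using snoc by simp
    also have "\<dots> = twist k x ?y \<cdot> (twist k x b \<cdot> twist k x ?c)"
      using in_k by (simp only: assoc X)
    also have "twist k x b \<cdot> twist k x ?c = twist k x (b \<cdot> ?c)"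
      using hom[OF b c] by simp
    finally show ?case .
  qed
qed

text \<open>
  With \<open>a = a' \<cdot> y\<close> and \<open>b = b' \<cdot> z\<close>, the product is
  \<open>a \<cdot> b = (a' \<cdot> \<phi>\<^sub>y(b')) \<cdot> (y z)\<close>, which is in increasing order. After \<open>\<phi>\<^sub>x\<close> is applied
  to the factors, the swap lemma moves \<open>\<phi>\<^sub>x(y)\<close> back to the left of \<open>\<phi>\<^sub>x(b')\<close>.
\<close>

lemma twist_hom:
  assumes "k < r" and x: "x \<in> carrier (H (Suc k))"
    and assoc: "\<And>a b c. \<lbrakk>a \<in> R k; b \<in> R k; c \<in> R k\<rbrakk> \<Longrightarrow> (a \<cdot> b) \<cdot> c = a \<cdot> (b \<cdot> c)"
    and gens: "\<And>i j b c. \<lbrakk>i \<le> j; j < k; b \<in> carrier (H (Suc j)); c \<in> carrier (H (Suc i))\<rbrakk> \<Longrightarrow>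
      twist k x (embed (Suc j) b \<cdot> embed (Suc i) c)
      = twist k x (embed (Suc j) b) \<cdot> twist k x (embed (Suc i) c)"
    and "a \<in> R k" "b \<in> R k"
  shows "twist k x (a \<cdot> b) = twist k x a \<cdot> twist k x b"
proof -
  have "\<forall>a\<in>R l. \<forall>b\<in>R l. twist k x (a \<cdot> b) = twist k x a \<cdot> twist k x b" if "l \<le> k" for l
    using that
  proof (induction l)
    case 0
    then show ?case
      using assms(1) x by (simp add: R_0 twist_unit mult_unit[OF _ unit_in_R, of 0])
  next
    case (Suc l)
    have lk: "l < k" and lr: "l < r" using Suc.prems assms(1) by auto
    have hom: "twist k x (a \<cdot> b) = twist k x a \<cdot> twist k x b" if "a \<in> R l" "b \<in> R l" for a b
      using Suc.IH lk that by simp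
    have sub: "R l \<subseteq> R k" using R_mono lk by simp
    have X: "twist k x a \<in> R k" if "a \<in> R k" for a
      using twist_in_R[OF \<open>k < r\<close> x that le_refl] .
    have M: "a \<cdot> b \<in> R k" if "a \<in> R k" "b \<in> R k" for a b
      using mult_closed assms(1) that by simp
    show ?case
    proof (intro ballI)
      fix a b assume a_in: "a \<in> R (Suc l)" and b_in: "b \<in> R (Suc l)"
      obtain a' y where a': "a' \<in> R l" and y: "y \<in> carrier (H (Suc l))"
        and a: "a = a' \<cdot> embed (Suc l) y"
        using R_Suc_mult_cases[OF a_in lr] by blast
      obtain b' z where b': "b' \<in> R l" and z: "z \<in> carrier (H (Suc l))"
        and b: "b = b' \<cdot> embed (Suc l) z"
        using R_Suc_mult_cases[OF b_in lr] by blast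
      let ?y = "embed (Suc l) y" and ?z = "embed (Suc l) z" and ?t = "twist l y b'"
      have t: "?t \<in> R l" using twist_in_R[OF lr y b' le_refl] .
      have yz: "y \<otimes>\<^bsub>H (Suc l)\<^esub> z \<in> carrier (H (Suc l))"
        using y z group_H[of "Suc l"] lr by (simp add: group.is_monoid monoid.m_closed)
      have in_k: "a' \<in> R k" "b' \<in> R k" "?t \<in> R k" "?y \<in> R k" "?z \<in> R k"
        using a' b' t sub embed_in_R[of "Suc l" k] lk lr y z by auto
      have "a \<cdot> b = a' \<cdot> ((?y \<cdot> b') \<cdot> ?z)"
        using in_k by (simp add: a b assoc M)
      also have "?y \<cdot> b' = ?t \<cdot> ?y"
        using embed_mult[OF lr y b'] .
      also have "a' \<cdot> ((?t \<cdot> ?y) \<cdot> ?z) = (a' \<cdot> ?t) \<cdot> embed (Suc l) (y \<otimes>\<^bsub>H (Suc l)\<^esub> z)"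
        using in_k by (simp add: assoc M flip: embed_mult_embed[OF lr y z])
      finally have "twist k x (a \<cdot> b)
          = twist k x (a' \<cdot> ?t) \<cdot> twist k x (embed (Suc l) (y \<otimes>\<^bsub>H (Suc l)\<^esub> z))"
        using twist_mult_embed[OF assms(1) lk x mult_closed[OF _ a' t] yz] lr by simp
      also have "\<dots> = (twist k x a' \<cdot> twist k x ?t) \<cdot> (twist k x ?y \<cdot> twist k x ?z)"
        using hom[OF a' t] gens[OF le_refl lk y z] by (simp add: embed_mult_embed[OF lr y z])
      also have "\<dots> = twist k x a' \<cdot> ((twist k x ?t \<cdot> twist k x ?y) \<cdot> twist k x ?z)"
        using in_k by (simp add: assoc M X)
      also have "twist k x ?t \<cdot> twist k x ?y = twist k x ?y \<cdot> twist k x b'"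
        using gens lk y less_imp_le
        by (intro twist_mult_swap[OF assms(1) lk x y assoc _ hom b']) auto
      also have "twist k x a' \<cdot> ((twist k x ?y \<cdot> twist k x b') \<cdot> twist k x ?z)
          = (twist k x a' \<cdot> twist k x ?y) \<cdot> (twist k x b' \<cdot> twist k x ?z)"
        using in_k by (simp add: assoc M X)
      also have "\<dots> = twist k x a \<cdot> twist k x b"
        using twist_mult_embed[OF assms(1) lk x] a' b' y z by (simp add: a b)
      finally show "twist k x (a \<cdot> b) = twist k x a \<cdot> twist k x b" .
    qed
  qed
  then show ?thesis
    using assms(5,6) by blast
qed

lemma update_inject: "\<lbrakk>a \<in> R k; b \<in> R k; a(Suc k := x) = b(Suc k := x)\<rbrakk> \<Longrightarrow> a = b"
  by (metis trunc_update)

text \<open>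
  Once the twists are known to be endomorphisms that compose as an action, both bracketings of
  \<open>(a, x) (b, y) (c, z)\<close> have first component \<open>a \<cdot> \<phi>\<^sub>x(b) \<cdot> \<phi>\<^sub>x(\<phi>\<^sub>y(c))\<close>.
\<close>

lemma mult_assoc:
  assumes triples: "\<And>i j k a b c. \<lbrakk>1 \<le> i; i \<le> j; j \<le> k; k \<le> r;
      a \<in> carrier (H k); b \<in> carrier (H j); c \<in> carrier (H i)\<rbrakk>
      \<Longrightarrow> (embed k a \<cdot> embed j b) \<cdot> embed i c = embed k a \<cdot> (embed j b \<cdot> embed i c)"
    and "a \<in> R r" "b \<in> R r" "c \<in> R r"
  shows "(a \<cdot> b) \<cdot> c = a \<cdot> (b \<cdot> c)"
proof -
  have "\<forall>a\<in>R k. \<forall>b\<in>R k. \<forall>c\<in>R k. (a \<cdot> b) \<cdot> c = a \<cdot> (b \<cdot> c)" if "k \<le> r" for k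
    using that
  proof (induction k)
    case 0
    then show ?case by (simp add: R_0 mult_unit[OF _ unit_in_R, of 0])
  next
    case (Suc k)
    have kr: "k < r" using Suc.prems by simp
    interpret grp: group "H (Suc k)" using group_H kr by simp
    have assoc: "(a \<cdot> b) \<cdot> c = a \<cdot> (b \<cdot> c)" if "a \<in> R k" "b \<in> R k" "c \<in> R k" for a b c
      using Suc.IH kr that by simp
    have X: "twist k x a \<in> R k" if "x \<in> carrier (H (Suc k))" "a \<in> R k" for x a
      using twist_in_R[OF kr that le_refl] .
    have M: "a \<cdot> b \<in> R k" if "a \<in> R k" "b \<in> R k" for a b
      using mult_closed kr that by simp
    have E: "embed (Suc i) h \<in> R k" if "i < k" "h \<in> carrier (H (Suc i))" for i h
      using embed_in_R[of "Suc i" k h] kr that by simp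
    have update: "a(Suc k := x) \<cdot> b = (a \<cdot> twist k x b)(Suc k := x)"
      if "a \<in> R k" "b \<in> R k" "x \<in> carrier (H (Suc k))" for a b x
      using mult_update[OF kr that grp.one_closed] that by (simp add: update_one kr)
    have left: "embed (Suc k) x \<cdot> b = (twist k x b)(Suc k := x)"
      if "b \<in> R k" "x \<in> carrier (H (Suc k))" for b x
      using update[OF unit_in_R that] X that kr mult_unit[of k] by (simp add: embed_Suc)
    have hom: "twist k x (a \<cdot> b) = twist k x a \<cdot> twist k x b"
      if "x \<in> carrier (H (Suc k))" "a \<in> R k" "b \<in> R k" for x a b
      using kr \<open>x \<in> carrier (H (Suc k))\<close> assoc _ \<open>a \<in> R k\<close> \<open>b \<in> R k\<close>
    proof (rule twist_hom)
      fix i j b c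
      assume *: "i \<le> j" "j < k" "b \<in> carrier (H (Suc j))" "c \<in> carrier (H (Suc i))"
      let ?b = "embed (Suc j) b" and ?c = "embed (Suc i) c"
      have bc: "?b \<in> R k" "?c \<in> R k" using E * by auto
      \<comment> \<open>both sides have last entry \<open>x\<close>; their remaining entries give the claim\<close>
      have "(embed (Suc k) x \<cdot> ?b) \<cdot> ?c = embed (Suc k) x \<cdot> (?b \<cdot> ?c)"
        using triples[of "Suc i" "Suc j" "Suc k"] * that kr by simp
      then have "(twist k x (?b \<cdot> ?c))(Suc k := x)
          = (twist k x ?b \<cdot> twist k x ?c)(Suc k := x)"
        using that bc by (simp add: left update M X del: fun_upd_apply)
      then show "twist k x (?b \<cdot> ?c) = twist k x ?b \<cdot> twist k x ?c"
        by (rule update_inject[rotated 2]) (use that bc in \<open>simp_all add: M X\<close>)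
    qed
    have act: "twist k (x \<otimes>\<^bsub>H (Suc k)\<^esub> y) c = twist k x (twist k y c)"
      if x: "x \<in> carrier (H (Suc k))" and y: "y \<in> carrier (H (Suc k))" and "c \<in> R k" for x y c
      using \<open>c \<in> R k\<close> less_imp_le[OF kr]
    proof (induction c rule: R_induct)
      case unit
      then show ?case using x y kr by (simp add: twist_unit)
    next
      case (snoc l b h)
      let ?c = "embed (Suc l) h"
      have b: "b \<in> R k" using snoc R_mono[of l k] by auto
      have c: "?c \<in> R k" using E snoc by simp
      have "(embed (Suc k) x \<cdot> embed (Suc k) y) \<cdot> ?c = embed (Suc k) x \<cdot> (embed (Suc k) y \<cdot> ?c)"
        using triples[of "Suc l" "Suc k" "Suc k"] snoc x y kr by simp
      moreover have "embed (Suc k) x \<cdot> (twist k y ?c)(Suc k := y)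
          = (twist k x (twist k y ?c))(Suc k := x \<otimes>\<^bsub>H (Suc k)\<^esub> y)"
        using mult_update[OF kr unit_in_R X[OF y c] x y] X x y c kr mult_unit[of k]
        by (simp add: embed_Suc)
      ultimately have "(twist k (x \<otimes>\<^bsub>H (Suc k)\<^esub> y) ?c)(Suc k := x \<otimes>\<^bsub>H (Suc k)\<^esub> y)
          = (twist k x (twist k y ?c))(Suc k := x \<otimes>\<^bsub>H (Suc k)\<^esub> y)"
        using x y c by (simp add: embed_mult_embed[OF kr] left)
      then have "twist k (x \<otimes>\<^bsub>H (Suc k)\<^esub> y) ?c = twist k x (twist k y ?c)"
        by (rule update_inject[rotated 2]) (use x y c in \<open>simp_all add: X\<close>)
      then show ?case
        using snoc b c x y by (simp add: hom X)
    qed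
    show ?case
    proof (intro ballI)
      fix a b c assume *: "a \<in> R (Suc k)" "b \<in> R (Suc k)" "c \<in> R (Suc k)"
      obtain a' x where a: "a' \<in> R k" "x \<in> carrier (H (Suc k))" "a = a'(Suc k := x)"
        using R_Suc_cases[OF *(1) kr] by blast
      obtain b' y where b: "b' \<in> R k" "y \<in> carrier (H (Suc k))" "b = b'(Suc k := y)"
        using R_Suc_cases[OF *(2) kr] by blast
      obtain c' z where c: "c' \<in> R k" "z \<in> carrier (H (Suc k))" "c = c'(Suc k := z)"
        using R_Suc_cases[OF *(3) kr] by blast
      show "(a \<cdot> b) \<cdot> c = a \<cdot> (b \<cdot> c)"
        using a b c kr
        by (simp add: mult_update M X hom act assoc grp.m_assoc del: fun_upd_apply)
    qed
  qed
  then show ?thesis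
    using assms(2-4) by (meson le_refl)
qed

end

theorem theorem5p2:
  fixes r :: nat
    and H :: "nat \<Rightarrow> ('a, 'b) monoid_scheme"
    and act :: "nat \<Rightarrow> nat \<Rightarrow> 'a \<Rightarrow> 'a \<Rightarrow> 'a"
    and br :: "nat \<Rightarrow> nat \<Rightarrow> nat \<Rightarrow> 'a \<Rightarrow> 'a \<Rightarrow> 'a"
  defines "G \<equiv> total_system.G r H"
    and "e \<equiv> total_system.embed r H"
    and "m \<equiv> total_system.mult r H act br"
  assumes "normalized_total_system r H act br"
    and "\<And>i j k a b c. \<lbrakk>1 \<le> i; i \<le> j; j \<le> k; k \<le> r;
           a \<in> carrier (H k); b \<in> carrier (H j); c \<in> carrier (H i)\<rbrakk>
         \<Longrightarrow> m (m (e k a) (e j b)) (e i c) = m (e k a) (m (e j b) (e i c))"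
  shows "\<forall>x\<in>G. \<forall>y\<in>G. \<forall>z\<in>G. m (m x y) z = m x (m y z)"
proof -
  interpret normalized_total_system r H act br by fact
  have "(x \<cdot> y) \<cdot> z = x \<cdot> (y \<cdot> z)" if "x \<in> R r" "y \<in> R r" "z \<in> R r" for x y z
    by (rule mult_assoc[OF _ that], rule assms(5)[unfolded e_def m_def])
  then show ?thesis
    unfolding assms(1) m_def R_r by blast
qed

end
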